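(* For every $s\in\mathbb{C}$ with $\Re(s)>1$, $$\sum_{n=1}^{\infty}\frac{1}{n^{s}}\cdot\frac{1}{\omega(n)+1}\cdot\Bigg[\sum_{p\in\mathbb{P}}\frac{1}{p^{s}}+\frac{1}{\omega(n)}\sum_{p\mid n}\frac{1}{p^{s}}\Bigg]=\zeta(s)-1,$$ where for $n=1$ the term $\frac{1}{\omega(n)}\sum_{p\mid n}\frac{1}{p^{s}}$ is interpreted as $0$.
   Context: $\mathbb{P}$ is the set of prime numbers, $\omega(n)$ is the number of distinct primes dividing $n$, sums over $p\mid n$ run over primes $p$ dividing $n$, and $\zeta(s)=\sum_{n\ge1}n^{-s}$ for $\Re(s)>1$. *)

theory Defs
  imports "HOL-Analysis.Analysis" "HOL-Computational_Algebra.Primes"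
begin

definition prime_omega :: "nat \<Rightarrow> nat" where
  "prime_omega n = card {p. prime p \<and> p dvd n}"

(* The Dirichlet series only, so the value is meaningful just for Re s > 1. *)
definition zeta :: "complex \<Rightarrow> complex" where
  "zeta s = (\<Sum>k. 1 / of_nat (Suc k) powr s)"

end

theory Submission
  imports Defs
begin

text \<open>
  Write \<open>\<omega>\<close> for the number of distinct prime divisors and put \<open>f n = 1 / n powr s\<close>, which is
  completely multiplicative and absolutely summable.  An integer \<open>n \<ge> 2\<close> has exactly \<open>\<omega> n\<close> factorisations \<open>n = m p\<close> with \<open>p\<close> prime,
  so weighting each of them by \<open>1 / \<omega> (m p)\<close> gives
  \[ \sum_{n \ge 2} f(n) = \sum_{m \ge 1} \sum_p \frac{f(m) f(p)}{\omega(m p)}. \]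
  On the right, \<open>\<omega> (m p) = \<omega> m + 1\<close> unless \<open>p\<close> divides \<open>m\<close>, when \<open>\<omega> (m p) = \<omega> m\<close>.  Replacing the
  weight by \<open>1 / (\<omega> m + 1)\<close> throughout thus has to be corrected by adding
  \<open>1 / \<omega> m - 1 / (\<omega> m + 1) = 1 / (\<omega> m (\<omega> m + 1))\<close>, times \<open>f m f p\<close>, for each of the finitely many
  \<open>p\<close> dividing \<open>m\<close>, and the inner sum becomes the term of the series in question.  The rearrangement is legitimate because the
  double series is dominated by the product of the absolutely convergent series of \<open>f m\<close> and \<open>f p\<close>
  (lemma \<open>abs_summable_prime_shift\<close>); the two evaluations are \<open>has_sum_prime_shift_by_product\<close> and
  \<open>has_sum_prime_shift_inner\<close>.
\<close>

text \<open>
  Two notions of absolute summability share the infix \<open>abs_summable_on\<close>; the one meant below is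
  \<open>(\<lambda>x. norm (f x)) summable_on A\<close>.
\<close>

no_notation Infinite_Set_Sum.abs_summable_on (infix \<open>abs'_summable'_on\<close> 50)

lemma finite_prime_divisors: "n > 0 \<Longrightarrow> finite {p::nat. prime p \<and> p dvd n}"
  by (rule finite_subset[of _ "{..n}"]) (auto dest: dvd_imp_le)

lemma prime_omega_pos:
  assumes "n \<ge> 2"
  shows "prime_omega n > 0"
proof -
  obtain p where "prime p" "p dvd n"
    using assms prime_factor_nat[of n] by auto
  then show ?thesis
    using finite_prime_divisors[of n] assms by (auto simp: prime_omega_def card_gt_0_iff)
qed

lemma prime_omega_mult_prime:
  assumes "m > 0" and "prime p"
  shows "prime_omega (m * p) = (if p dvd m then prime_omega m else prime_omega m + 1)"
proof -
  have "{q. prime q \<and> q dvd m * p} = insert p {q. prime q \<and> q dvd m}"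
    using assms(2) by (auto simp: prime_dvd_mult_iff primes_dvd_imp_eq)
  then show ?thesis
    using finite_prime_divisors[OF assms(1)] assms(2)
    by (auto simp: prime_omega_def card_insert_if)
qed

text \<open>
  The weight \<open>1 / \<omega> (m p)\<close> has modulus at most 1, so the product of two absolutely convergent series
  dominates the double series.
\<close>

lemma abs_summable_prime_shift:
  fixes f :: "nat \<Rightarrow> 'a :: {real_normed_field, banach}"
  assumes "f abs_summable_on {1..}"
  shows "(\<lambda>(m, p). f m * f p / of_nat (prime_omega (m * p)))
           abs_summable_on {1..} \<times> {p. prime p}"
proof (rule Infinite_Sum.abs_summable_on_comparison_test)
  have P: "f abs_summable_on {p. prime p}"
    by (rule summable_on_subset_banach[OF assms]) (auto dest: prime_gt_0_nat)
  show "(\<lambda>(m, p). f m * f p) abs_summable_on {1..} \<times> {p. prime p}"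
    unfolding Infinite_Sum.abs_summable_on_Sigma_iff
    using assms P
    by (auto simp: norm_mult infsum_cmult_right' abs_mult
             intro!: summable_on_cmult_right summable_on_cmult_left)
next
  fix x :: "nat \<times> nat"
  assume x: "x \<in> {1..} \<times> {p. prime p}"
  obtain m p where [simp]: "x = (m, p)" by (cases x)
  have "m * p \<ge> 1 * 2"
    using x by (intro mult_le_mono) (auto dest: prime_ge_2_nat)
  then have "real (prime_omega (m * p)) \<ge> 1"
    using prime_omega_pos[of "m * p"] by simp
  then show "norm (case x of (m, p) \<Rightarrow> f m * f p / of_nat (prime_omega (m * p)))
               \<le> norm (case x of (m, p) \<Rightarrow> f m * f p)"
    by (auto simp: norm_divide divide_le_eq mult_le_cancel_left1 simp flip: norm_mult)
qed

text \<open>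
  Collecting the pairs \<open>(m, p)\<close> by their product \<open>n = m p\<close>: the fibre over \<open>n\<close> has \<open>\<omega> n\<close> elements, all
  of which contribute \<open>f n / \<omega> n\<close>.
\<close>

lemma has_sum_prime_shift_by_product:
  fixes f :: "nat \<Rightarrow> 'a :: {real_normed_field, banach}"
  assumes mult: "\<And>m n. m > 0 \<Longrightarrow> n > 0 \<Longrightarrow> f (m * n) = f m * f n"
  assumes abs: "f abs_summable_on {1..}"
  shows "((\<lambda>(m, p). f m * f p / of_nat (prime_omega (m * p)))
            has_sum infsum f {2..}) ({1..} \<times> {p. prime p})"
proof -
  define A where "A = {1::nat..} \<times> {p::nat. prime p}"
  define B where "B = (SIGMA n:{2::nat..}. {p. prime p \<and> p dvd n})"
  define G where "G = (\<lambda>(m, p). f m * f p / of_nat (prime_omega (m * p)))"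
  define H where "H = (\<lambda>(n, p::nat). f n / of_nat (prime_omega n))"
  have bij: "bij_betw (\<lambda>(m, p). (m * p, p)) A B"
  proof (rule bij_betw_byWitness[where f' = "\<lambda>(n, p). (n div p, p)"])
    have "2 \<le> m * p" if "1 \<le> m" "prime p" for m p :: nat
      using mult_le_mono[OF that(1) prime_ge_2_nat[OF that(2)]] by simp
    then show "(\<lambda>(m, p). (m * p, p)) ` A \<subseteq> B"
      by (auto simp: A_def B_def)
    show "(\<lambda>(n, p). (n div p, p)) ` B \<subseteq> A"
      by (auto simp: A_def B_def Suc_le_eq div_greater_zero_iff dvd_imp_le prime_gt_0_nat)
  qed (auto simp: A_def B_def prime_gt_0_nat)
  have GH: "G x = H (case x of (m, p) \<Rightarrow> (m * p, p))" if "x \<in> A" for x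
    using that by (auto simp: A_def G_def H_def mult prime_gt_0_nat)
  have "G summable_on A"
    unfolding G_def A_def by (rule Infinite_Sum.abs_summable_summable[OF abs_summable_prime_shift[OF abs]])
  then obtain T where T: "(G has_sum T) A"
    by (auto simp: summable_on_def)
  also have "(G has_sum T) A \<longleftrightarrow> ((\<lambda>x. H (case x of (m, p) \<Rightarrow> (m * p, p))) has_sum T) A"
    by (rule has_sum_cong) (rule GH)
  also have "\<dots> \<longleftrightarrow> (H has_sum T) B"
    by (rule has_sum_reindex_bij_betw[OF bij])
  finally have HB: "(H has_sum T) (SIGMA n:{2..}. {p. prime p \<and> p dvd n})"
    unfolding B_def .
  have "(f has_sum T) {2..}"
  proof (rule has_sum_SigmaD[OF HB])
    fix n :: nat
    assume "n \<in> {2..}"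
    then have "prime_omega n > 0" and fin: "finite {p. prime p \<and> p dvd n}"
      using prime_omega_pos finite_prime_divisors[of n] by auto
    then have "f n = (\<Sum>p | prime p \<and> p dvd n. H (n, p))"
      by (simp add: H_def flip: prime_omega_def)
    then show "((\<lambda>p. H (n, p)) has_sum f n) {p. prime p \<and> p dvd n}"
      by (intro has_sum_finiteI fin)
  qed
  then have "T = infsum f {2..}"
    by (simp add: infsumI)
  with T show ?thesis
    by (simp add: G_def A_def)
qed

text \<open>
  For fixed \<open>m\<close>, the summand differs from \<open>f m * f p / (\<omega> m + 1)\<close> only at the finitely many primes
  \<open>p\<close> that divide \<open>m\<close>.
\<close>

lemma has_sum_prime_shift_inner:
  fixes f :: "nat \<Rightarrow> 'a :: real_normed_field"
  assumes "f summable_on {p. prime p}" and "m > 0"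
  shows "((\<lambda>p. f m * f p / of_nat (prime_omega (m * p))) has_sum
            f m * (1 / (of_nat (prime_omega m) + 1)) *
              ((\<Sum>\<^sub>\<infinity>p | prime p. f p) +
               1 / of_nat (prime_omega m) * (\<Sum>p | prime p \<and> p dvd m. f p)))
          {p. prime p}"
proof -
  define D where "D = {p::nat. prime p \<and> p dvd m}"
  define w :: 'a where "w = of_nat (prime_omega m)"
  have fin: "finite D"
    unfolding D_def by (rule finite_prime_divisors[OF assms(2)])
  have w: "w + 1 \<noteq> 0"
    unfolding w_def by (metis of_nat_Suc of_nat_eq_0_iff add.commute nat.distinct(2))
  have split: "f m * f p / of_nat (prime_omega (m * p)) =
      f m * (1 / (w + 1)) * (f p + (if p \<in> D then 1 / w * f p else 0))" if "prime p" for p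
  proof (cases "p dvd m")
    case True
    then have "p \<in> D"
      using that by (simp add: D_def)
    then have "w \<noteq> 0"
      using fin by (auto simp: w_def prime_omega_def simp flip: D_def)
    then have "1 / w = 1 / (w + 1) * (1 + 1 / w)"
      using w by (simp add: divide_simps)
    then have "f m * f p / w = f m * (1 / (w + 1)) * (f p + 1 / w * f p)"
      by (metis (no_types, lifting) distrib_right mult.assoc mult.commute mult_1
            times_divide_eq_right mult.right_neutral)
    then show ?thesis
      using True that assms(2) \<open>p \<in> D\<close> by (simp add: prime_omega_mult_prime flip: w_def)
  next
    case False
    then show ?thesis
      using that assms(2) by (simp add: D_def prime_omega_mult_prime add.commute flip: w_def)
  qed
  have "((\<lambda>p. if p \<in> D then 1 / w * f p else 0) has_sum (1 / w * (\<Sum>p\<in>D. f p))) {p. prime p}"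
    by (rule has_sum_finite_neutralI[OF fin]) (auto simp: D_def sum_distrib_left)
  then have "((\<lambda>p. f m * (1 / (w + 1)) * (f p + (if p \<in> D then 1 / w * f p else 0))) has_sum
      f m * (1 / (w + 1)) * ((\<Sum>\<^sub>\<infinity>p | prime p. f p) + 1 / w * (\<Sum>p\<in>D. f p))) {p. prime p}"
    by (intro has_sum_cmult_right has_sum_add has_sum_infsum assms(1))
  also have "?this \<longleftrightarrow> ((\<lambda>p. f m * f p / of_nat (prime_omega (m * p))) has_sum
      f m * (1 / (w + 1)) * ((\<Sum>\<^sub>\<infinity>p | prime p. f p) + 1 / w * (\<Sum>p\<in>D. f p))) {p. prime p}"
    by (rule has_sum_cong) (simp only: split mem_Collect_eq)
  finally show ?thesis
    by (simp only: D_def w_def)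
qed

text \<open>
  At \<open>n = 1\<close> the term with \<open>1 / \<omega> n\<close> is \<open>1 / 0\<close> times an empty sum, hence 0, which is the value
  that the interpretation of the series prescribes there.
\<close>

lemma has_sum_completely_multiplicative_prime_omega:
  fixes f :: "nat \<Rightarrow> 'a :: {real_normed_field, banach}"
  assumes mult: "\<And>m n. m > 0 \<Longrightarrow> n > 0 \<Longrightarrow> f (m * n) = f m * f n"
  assumes abs: "f abs_summable_on {1..}"
  shows "((\<lambda>n. f n * (1 / (of_nat (prime_omega n) + 1)) *
            ((\<Sum>\<^sub>\<infinity>p | prime p. f p) +
             1 / of_nat (prime_omega n) * (\<Sum>p | prime p \<and> p dvd n. f p)))
          has_sum infsum f {2..}) {1..}"
proof (rule has_sum_SigmaD[OF has_sum_prime_shift_by_product[OF mult abs]])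
  have "f summable_on {p. prime p}"
    by (rule summable_on_subset_banach[OF Infinite_Sum.abs_summable_summable[OF abs]])
       (auto dest: prime_gt_0_nat)
  then show "((\<lambda>p. case (m, p) of (m, p) \<Rightarrow> f m * f p / of_nat (prime_omega (m * p))) has_sum
      f m * (1 / (of_nat (prime_omega m) + 1)) *
        ((\<Sum>\<^sub>\<infinity>p | prime p. f p) +
         1 / of_nat (prime_omega m) * (\<Sum>p | prime p \<and> p dvd m. f p))) {p. prime p}"
    if "m \<in> {1..}" for m
    using has_sum_prime_shift_inner[of f m] that by simp
qed auto

lemma zeta_has_sum:
  fixes s :: complex
  assumes "Re s > 1"
  shows "(\<lambda>n. 1 / of_nat n powr s :: complex) abs_summable_on {1..}"
    and "((\<lambda>n. 1 / of_nat n powr s) has_sum zeta s) {1..}"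
proof -
  have bij: "bij_betw Suc UNIV {1..}"
    by (rule bij_betw_byWitness[where f' = "\<lambda>n. n - 1"]) auto
  have "norm (1 / of_nat (Suc k) powr s :: complex) = real (Suc k) powr (- Re s)" for k
    using norm_powr_real_powr[of "of_nat (Suc k)" s]
    by (simp add: norm_divide powr_minus inverse_eq_divide del: of_nat_Suc)
  moreover have "summable (\<lambda>k. real (Suc k) powr (- Re s))"
    unfolding summable_Suc_iff[of "\<lambda>k. real k powr (- Re s)"] summable_real_powr_iff
    using assms by simp
  ultimately have norm: "summable (\<lambda>k. norm (1 / of_nat (Suc k) powr s :: complex))"
    by simp
  then have "(\<lambda>k. 1 / of_nat (Suc k) powr s :: complex) abs_summable_on UNIV"
    by (simp add: summable_on_UNIV_nonneg_real_iff)
  then show "(\<lambda>n. 1 / of_nat n powr s :: complex) abs_summable_on {1..}"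
    using summable_on_reindex_bij_betw[OF bij, of "\<lambda>n. norm (1 / of_nat n powr s :: complex)"]
    by simp
  have "(\<lambda>k. 1 / of_nat (Suc k) powr s) sums zeta s"
    unfolding zeta_def by (rule summable_sums[OF summable_norm_cancel[OF norm]])
  then have "((\<lambda>k. 1 / of_nat (Suc k) powr s) has_sum zeta s) UNIV"
    by (rule norm_summable_imp_has_sum[OF norm])
  then show "((\<lambda>n. 1 / of_nat n powr s) has_sum zeta s) {1..}"
    using has_sum_reindex_bij_betw[OF bij, of "\<lambda>n. 1 / of_nat n powr s :: complex" "zeta s"]
    by simp
qed

theorem proposition4p5:
  fixes s :: complex
  assumes "Re s > 1"
  shows "(\<lambda>k. let n = Suc k in
           1 / of_nat n powr s * (1 / (of_nat (prime_omega n) + 1)) *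
           ((\<Sum>\<^sub>\<infinity>p | prime (p::nat). 1 / of_nat p powr s) +
            (if n = 1 then 0
             else 1 / of_nat (prime_omega n) *
                  (\<Sum>p | prime p \<and> p dvd n. 1 / of_nat p powr s))))
         sums (zeta s - 1)"
proof -
  define f :: "nat \<Rightarrow> complex" where "f = (\<lambda>n. 1 / of_nat n powr s)"
  define t where "t = (\<lambda>n. f n * (1 / (of_nat (prime_omega n) + 1)) *
      ((\<Sum>\<^sub>\<infinity>p | prime p. f p) +
       1 / of_nat (prime_omega n) * (\<Sum>p | prime p \<and> p dvd n. f p)))"
  have abs: "f abs_summable_on {1..}" and zeta: "(f has_sum zeta s) {1..}"
    unfolding f_def by (rule zeta_has_sum[OF assms])+
  have mult: "f (m * n) = f m * f n" for m n
    by (simp add: f_def powr_times_real)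
  have "f summable_on {2..}"
    by (rule summable_on_subset_banach[OF Infinite_Sum.abs_summable_summable[OF abs]]) auto
  then have "(f has_sum f 1 + infsum f {2..}) (insert 1 {2..})"
    by (intro has_sum_insert has_sum_infsum) auto
  moreover have "insert 1 {2..} = {1::nat..}"
    by auto
  ultimately have "infsum f {2..} = zeta s - 1"
    using has_sum_unique[OF zeta] by (simp add: f_def algebra_simps)
  then have "(t has_sum (zeta s - 1)) {1..}"
    using has_sum_completely_multiplicative_prime_omega[OF mult abs] by (simp add: t_def)
  moreover have "bij_betw Suc UNIV {1..}"
    by (rule bij_betw_byWitness[where f' = "\<lambda>n. n - 1"]) auto
  ultimately have sums: "(\<lambda>k. t (Suc k)) sums (zeta s - 1)"
    by (intro has_sum_imp_sums) (simp add: has_sum_reindex_bij_betw)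
  have no_prime: "{p::nat. prime p \<and> p dvd Suc 0} = {}"
    by auto
  show ?thesis
    by (rule iffD1[OF sums_cong sums]) (auto simp: t_def f_def Let_def no_prime)
qed

end
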